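(* Let $(Q_{n1})_n$ and $(Q_{n2})_n$ be sequences of probability distributions on $\mathbb{R}$ converging weakly to probability distributions $Q_1$ and $Q_2$, respectively. If $Q_{n1}\le_{\rm lr} Q_{n2}$ for all $n$, then $Q_1\le_{\rm lr} Q_2$.
   Context: Likelihood ratio order: for probability measures $Q_1,Q_2$ on $\mathbb{R}$ (with Borel $\sigma$-field), $Q_1\le_{\rm lr}Q_2$ means that there exist a $\sigma$-finite measure $\mu$ and densities $g_j=\mathrm{d}Q_j/\mathrm{d}\mu:\mathbb{R}\to[0,\infty)$ ($j=1,2$) such that $g_2/g_1$ (with values in $[0,\infty]$, $c/0:=\infty$ for $c>0$) is non-decreasing on $\{g_1+g_2>0\}$. *)

theory Defs
  imports "HOL-Probability.Probability"
begin

text \<open>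
  Likelihood ratio order on Borel probability measures on the real line. The densities take
  finite values in the nonnegative reals; their ratio is formed in \<^typ>\<open>ennreal\<close>, where
  \<^term>\<open>c / 0 = \<infinity>\<close> for \<^term>\<open>c > 0\<close>. The library's value of \<^term>\<open>0 / 0\<close> is irrelevant, since such
  points lie outside the set on which monotonicity is required.
\<close>

definition lr_le :: "real measure \<Rightarrow> real measure \<Rightarrow> bool"  (infix "\<le>\<^sub>l\<^sub>r" 50) where
  "Q1 \<le>\<^sub>l\<^sub>r Q2 \<longleftrightarrow>
    (\<exists>(\<mu> :: real measure) (g1 :: real \<Rightarrow> real) (g2 :: real \<Rightarrow> real).
       sigma_finite_measure \<mu> \<and> sets \<mu> = sets borel \<and>
       g1 \<in> borel_measurable borel \<and> g2 \<in> borel_measurable borel \<and>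
       (\<forall>x. 0 \<le> g1 x) \<and> (\<forall>x. 0 \<le> g2 x) \<and>
       Q1 = density \<mu> (\<lambda>x. ennreal (g1 x)) \<and>
       Q2 = density \<mu> (\<lambda>x. ennreal (g2 x)) \<and>
       mono_on {x. g1 x + g2 x > 0} (\<lambda>x. ennreal (g2 x) / ennreal (g1 x)))"

end

(*
  The relation Q1 \<le> Q2 in the likelihood ratio order is equivalent to the density-free inequality
  Q1(B) Q2(A) \<le> Q1(A) Q2(B) for all Borel sets A to the left of B. For half-open intervals this
  survives weak limits: shift all endpoints to the right by a common small amount so that they
  avoid the countably many atoms, let n tend to infinity, then let the shift tend to 0. It extends
  from intervals back to Borel sets. Conversely, given the inequality, let h be the density of Q2
  with respect to Q = Q1 + Q2. For each level c and point t, either h \<le> c almost everywhere on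
  (-oo, t] or h > c almost everywhere on (t, oo), so h agrees almost everywhere with the monotone
  function g(t) = ess sup of h over (-oo, t], and 1 - g and g are the required densities.
*)
theory Submission
  imports Defs
begin

section \<open>From monotone density ratio to cross inequality\<close>

text \<open>A non-decreasing ratio means \<open>g1 y * g2 x\<close> is at most
  \<open>g1 x * g2 y\<close> whenever \<open>x < y\<close>. Integrating this over \<open>x\<close>
  in \<open>A\<close> and \<open>y\<close> in \<open>B\<close> removes the densities.\<close>

lemma lr_le_cross:
  assumes "Q1 \<le>\<^sub>l\<^sub>r Q2" and A: "A \<in> sets borel" and B: "B \<in> sets borel"
    and AB: "\<And>x y. x \<in> A \<Longrightarrow> y \<in> B \<Longrightarrow> x < y"
  shows "emeasure Q1 B * emeasure Q2 A \<le> emeasure Q1 A * emeasure Q2 B"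
proof -
  obtain \<mu> :: "real measure" and g1 g2 :: "real \<Rightarrow> real"
    where sets: "sets \<mu> = sets borel"
      and g[measurable]: "g1 \<in> borel_measurable borel" "g2 \<in> borel_measurable borel"
      and nn: "\<And>x. 0 \<le> g1 x" "\<And>x. 0 \<le> g2 x"
      and Q: "Q1 = density \<mu> (\<lambda>x. ennreal (g1 x))" "Q2 = density \<mu> (\<lambda>x. ennreal (g2 x))"
      and mono: "mono_on {x. g1 x + g2 x > 0} (\<lambda>x. ennreal (g2 x) / ennreal (g1 x))"
    using assms(1) unfolding lr_le_def by blast
  note [measurable_cong] = sets and [measurable] = A B
  have pw: "ennreal (g1 y) * ennreal (g2 x) \<le> ennreal (g1 x) * ennreal (g2 y)" if "x < y" for x y
  proof (cases "g1 y = 0 \<or> g2 x = 0")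
    case False
    then have pos: "g1 y > 0" "g2 x > 0"
      using nn[of x] nn[of y] by auto
    have le: "ennreal (g2 x) / ennreal (g1 x) \<le> ennreal (g2 y) / ennreal (g1 y)"
      using monotone_onD[OF mono, of x y] that pos nn[of x] nn[of y] by auto
    also have "\<dots> = ennreal (g2 y / g1 y)"
      using pos nn by (simp add: divide_ennreal)
    \<comment> \<open>The ratio at \<open>y\<close> is finite, whereas \<open>g1 x = 0\<close>
      together with \<open>g2 x > 0\<close> would make the ratio at \<open>x\<close>
      infinite.\<close>
    finally have "g1 x \<noteq> 0"
      using pos by (auto simp: top_unique)
    then have "g1 x > 0"
      using nn(1)[of x] by simp
    then have "g2 x / g1 x \<le> g2 y / g1 y"
      using le pos nn by (simp add: divide_ennreal)
    then have "g1 y * g2 x \<le> g1 x * g2 y"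
      using pos \<open>g1 x > 0\<close> by (simp add: field_simps)
    then show ?thesis
      using nn by (simp flip: ennreal_mult)
  qed auto
  have "emeasure Q1 B * emeasure Q2 A
      = (\<integral>\<^sup>+y. (\<integral>\<^sup>+x. (ennreal (g1 y) * indicator B y) * (ennreal (g2 x) * indicator A x) \<partial>\<mu>) \<partial>\<mu>)"
    by (simp add: Q emeasure_density nn_integral_cmult nn_integral_multc)
  also have "\<dots> \<le> (\<integral>\<^sup>+y. (\<integral>\<^sup>+x. (ennreal (g2 y) * indicator B y) * (ennreal (g1 x) * indicator A x) \<partial>\<mu>) \<partial>\<mu>)"
    using pw AB by (intro nn_integral_mono) (auto simp: indicator_def mult.commute)
  also have "\<dots> = emeasure Q1 A * emeasure Q2 B"
    by (simp add: Q emeasure_density nn_integral_cmult nn_integral_multc mult.commute)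
  finally show ?thesis .
qed

section \<open>Sums of two measures\<close>

definition add_measure :: "'a measure \<Rightarrow> 'a measure \<Rightarrow> 'a measure" where
  "add_measure M N = measure_of (space M) (sets M) (\<lambda>A. emeasure M A + emeasure N A)"

lemma space_add_measure [simp]: "space (add_measure M N) = space M"
  and sets_add_measure [simp, measurable_cong]: "sets (add_measure M N) = sets M"
  by (simp_all add: add_measure_def)

lemma emeasure_add_measure:
  assumes "sets N = sets M" "A \<in> sets M"
  shows "emeasure (add_measure M N) A = emeasure M A + emeasure N A"
  unfolding add_measure_def
proof (rule emeasure_measure_of_sigma[OF _ _ _ \<open>A \<in> sets M\<close>])
  show "sigma_algebra (space M) (sets M)" ..
  show "positive (sets M) (\<lambda>A. emeasure M A + emeasure N A)"
    by (simp add: positive_def)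
  show "countably_additive (sets M) (\<lambda>A. emeasure M A + emeasure N A)"
    using assms(1) by (auto simp: countably_additive_def suminf_add[symmetric] suminf_emeasure)
qed

lemma finite_borel_measure_add_measure:
  assumes "finite_borel_measure M" "finite_borel_measure N"
  shows "finite_borel_measure (add_measure M N)"
proof -
  interpret M: finite_borel_measure M by fact
  interpret N: finite_borel_measure N by fact
  show ?thesis
  proof (intro finite_borel_measure.intro finite_borel_measure_axioms.intro finite_measureI)
    show "sets (add_measure M N) = sets borel"
      by (simp add: M.M_is_borel)
    show "emeasure (add_measure M N) (space (add_measure M N)) \<noteq> \<infinity>"
      using emeasure_add_measure[OF _ sets.top, of N M]
      by (simp add: M.M_is_borel N.M_is_borel M.emeasure_eq_measure N.emeasure_eq_measure)
  qed
qed

lemma measure_add_measure: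
  assumes "finite_borel_measure M" "finite_borel_measure N" "A \<in> sets borel"
  shows "measure (add_measure M N) A = measure M A + measure N A"
proof -
  interpret M: finite_borel_measure M by fact
  interpret N: finite_borel_measure N by fact
  show ?thesis
    using assms(3) emeasure_add_measure[of N M A]
    by (simp add: measure_def M.M_is_borel N.M_is_borel enn2real_plus less_top[symmetric])
qed

section \<open>From half-open intervals to Borel sets\<close>

lemma measure_le_of_Ioc_le:
  assumes "finite_borel_measure M" "finite_borel_measure N"
    and le: "\<And>a b. a < b \<Longrightarrow> measure M {a<..b} \<le> measure N {a<..b}"
    and A: "A \<in> sets borel"
  shows "measure M A \<le> measure N A"
proof -
  interpret M: finite_borel_measure M by fact
  interpret N: finite_borel_measure N by fact
  \<comment> \<open>The difference of the distribution functions is itself one, so \<open>N\<close> is \<open>M\<close> plus a measure.\<close>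
  define G where "G x = cdf N x - cdf M x" for x
  have mono: "G x \<le> G y" if "x \<le> y" for x y
    using le[of x y] that M.cdf_diff_eq[of x y] N.cdf_diff_eq[of x y]
    by (cases "x = y") (auto simp: G_def)
  have rc: "continuous (at_right a) G" for a
    unfolding G_def by (intro continuous_intros M.cdf_is_right_cont N.cdf_is_right_cont)
  have bot: "(G \<longlongrightarrow> 0) at_bot"
    unfolding G_def using tendsto_diff[OF N.cdf_lim_at_bot M.cdf_lim_at_bot] by simp
  have top: "(G \<longlongrightarrow> measure N (space N) - measure M (space M)) at_top"
    unfolding G_def by (intro tendsto_intros N.cdf_lim_at_top M.cdf_lim_at_top)
  let ?K = "interval_measure G"
  \<comment> \<open>The mass of \<open>?K\<close> is the limit of \<open>G\<close> at infinity, and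
    its limit at minus infinity is 0. Comparing \<open>G (- x)\<close> with \<open>G x\<close> for
    \<open>x\<close> at least 0 orders the two limits.\<close>
  have m0: "0 \<le> measure N (space N) - measure M (space M)"
  proof (rule tendsto_le[OF _ top bot[THEN filterlim_compose, OF filterlim_uminus_at_bot_at_top]])
    show "\<forall>\<^sub>F x in at_top. G (- x) \<le> G x"
      using eventually_ge_at_top[of 0] by eventually_elim (simp add: mono)
  qed simp
  have K: "finite_borel_measure ?K"
    by (rule finite_borel_measure_interval_measure[OF mono rc bot top m0])
  have "cdf (add_measure M ?K) = cdf N"
    by (auto simp: cdf_def measure_add_measure[OF assms(1) K] 
        measure_interval_measure_Iic[OF mono rc bot])
       (simp add: G_def cdf_def)
  then have "N = add_measure M ?K"
    using cdf_unique' finite_borel_measure_add_measure assms(1,2) K by metis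
  then show ?thesis
    using measure_add_measure[OF assms(1) K A] by simp
qed

text \<open>The comparison on intervals is applied to the measures \<open>R \<alpha> M\<close> and
  \<open>R \<beta> N\<close>, which are \<open>M\<close> and \<open>N\<close> scaled and cut down to
  \<open>S\<close>. Cutting down matters because the cross inequality is available only for
  intervals on one side of a point.\<close>

lemma scaled_measure_le_of_Ioc_le:
  assumes "finite_borel_measure M" "finite_borel_measure N" "0 \<le> \<alpha>" "0 \<le> \<beta>"
    and S: "S \<in> sets borel"
    and le: "\<And>a b. a < b \<Longrightarrow> \<alpha> * measure M ({a<..b} \<inter> S) \<le> \<beta> * measure N ({a<..b} \<inter> S)"
    and A: "A \<in> sets borel" "A \<subseteq> S"
  shows "\<alpha> * measure M A \<le> \<beta> * measure N A"
proof -
  define R where "R c P = density P (\<lambda>x. ennreal c * indicator S x)" for c and P :: "real measure"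
  have eq: "emeasure (R c P) B = ennreal (c * measure P (B \<inter> S))"
    if "finite_borel_measure P" "0 \<le> c" "B \<in> sets borel" for c P B
  proof -
    interpret P: finite_borel_measure P by fact
    note [measurable_cong] = P.M_is_borel and [measurable] = S that(3)
    have "emeasure (R c P) B = (\<integral>\<^sup>+x. ennreal c * indicator (B \<inter> S) x \<partial>P)"
      unfolding R_def by (subst emeasure_density)
        (auto intro!: nn_integral_cong simp: indicator_def)
    also have "\<dots> = ennreal c * emeasure P (B \<inter> S)"
      by (rule nn_integral_cmult_indicator) measurable
    finally show ?thesis
      using that(2) by (simp add: P.emeasure_eq_measure ennreal_mult)
  qed
  have fin: "finite_borel_measure (R c P)" if "finite_borel_measure P" "0 \<le> c" for c P
  proof -
    have "sets (R c P) = sets borel"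
      using finite_borel_measure.M_is_borel[OF that(1)] by (simp add: R_def)
    moreover from this have "emeasure (R c P) (space (R c P)) \<noteq> \<infinity>"
      using eq[OF that, of UNIV] sets_eq_imp_space_eq[of "R c P" borel] by simp
    ultimately show ?thesis
      by (intro finite_borel_measure.intro finite_borel_measure_axioms.intro finite_measureI)
  qed
  have meq: "measure (R c P) B = c * measure P (B \<inter> S)"
    if "finite_borel_measure P" "0 \<le> c" "B \<in> sets borel" for c P B
    using eq[OF that] that(2) by (simp add: measure_def)
  have "measure (R \<alpha> M) A \<le> measure (R \<beta> N) A"
  proof (rule measure_le_of_Ioc_le[OF fin fin _ A(1)])
    show "measure (R \<alpha> M) {a<..b} \<le> measure (R \<beta> N) {a<..b}" if "a < b" for a b
      using le[OF that] by (simp add: meq assms(1-4))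
  qed fact+
  moreover have "A \<inter> S = A"
    using A(2) by auto
  ultimately show ?thesis
    by (simp add: meq assms(1-4) A(1))
qed

text \<open>One set is extended at a time, the masses of the other serving as the scalars: first
  \<open>{a<..b}\<close> becomes \<open>A\<close> with \<open>{c<..d}\<close> fixed to the right of
  \<open>t\<close>, then \<open>{c<..d}\<close> becomes \<open>B\<close> with \<open>A\<close>
  fixed.\<close>

lemma cross_of_Ioc_cross:
  assumes Q: "finite_borel_measure Q1" "finite_borel_measure Q2"
    and le: "\<And>a b c d. a < b \<Longrightarrow> b \<le> c \<Longrightarrow> c < d \<Longrightarrow>
        measure Q1 {c<..d} * measure Q2 {a<..b} \<le> measure Q1 {a<..b} * measure Q2 {c<..d}"
    and A: "A \<in> sets borel" "A \<subseteq> {..t}" and B: "B \<in> sets borel" "B \<subseteq> {t<..}"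
  shows "measure Q1 B * measure Q2 A \<le> measure Q1 A * measure Q2 B"
proof -
  have 1: "measure Q1 {c<..d} * measure Q2 A \<le> measure Q2 {c<..d} * measure Q1 A"
    if "t \<le> c" "c < d" for c d
  proof (rule scaled_measure_le_of_Ioc_le[OF Q(2,1) _ _ _ _ A])
    fix a b :: real assume "a < b"
    have "{a<..b} \<inter> {..t} = {a<..min b t}" by auto
    then show "measure Q1 {c<..d} * measure Q2 ({a<..b} \<inter> {..t})
        \<le> measure Q2 {c<..d} * measure Q1 ({a<..b} \<inter> {..t})"
      using le[of a "min b t" c d] that \<open>a < b\<close>
      by (cases "a < min b t") (auto simp: mult.commute)
  qed auto
  have "measure Q2 A * measure Q1 B \<le> measure Q1 A * measure Q2 B"
  proof (rule scaled_measure_le_of_Ioc_le[OF Q _ _ _ _ B])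
    fix c d :: real assume "c < d"
    have "{c<..d} \<inter> {t<..} = {max c t<..d}" by auto
    then show "measure Q2 A * measure Q1 ({c<..d} \<inter> {t<..})
        \<le> measure Q1 A * measure Q2 ({c<..d} \<inter> {t<..})"
      using 1[of "max c t" d] by (cases "max c t < d") (auto simp: mult.commute)
  qed auto
  then show ?thesis by (simp add: mult.commute)
qed

section \<open>Passage to the weak limit\<close>

text \<open>Each point \<open>x\<close> of \<open>F\<close> forbids only the countably many offsets
  \<open>d - x\<close> with \<open>d\<close> in \<open>D\<close>, and an open interval is not
  exhausted by countably many points.\<close>

lemma exists_offset_avoiding_countable:
  fixes D :: "real set" and F :: "real set"
  assumes "countable D" "finite F"
  obtains e :: "nat \<Rightarrow> real" where "\<And>k. 0 < e k" "e \<longlonglongrightarrow> 0" "\<And>k x. x \<in> F \<Longrightarrow> x + e k \<notin> D"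
proof -
  have "\<exists>e\<in>{0<..<inverse (real (Suc k))}. e \<notin> (\<Union>x\<in>F. (\<lambda>d. d - x) ` D)" for k
    using assms by (intro open_minus_countable) (auto intro: countable_finite)
  then obtain e where e: "\<And>k. e k \<in> {0<..<inverse (real (Suc k))}"
      "\<And>k. e k \<notin> (\<Union>x\<in>F. (\<lambda>d. d - x) ` D)"
    by metis
  have "e \<longlonglongrightarrow> 0"
    by (rule tendsto_sandwich[OF _ _ tendsto_const LIMSEQ_inverse_real_of_nat])
       (use e(1) in \<open>auto intro!: always_eventually less_imp_le\<close>)
  moreover have "x + e k \<notin> D" if "x \<in> F" for k x
  proof
    assume "x + e k \<in> D"
    then have "e k \<in> (\<lambda>d. d - x) ` D"
      by (intro image_eqI[of _ _ "x + e k"]) auto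
    then show False using e(2)[of k] that by blast
  qed
  ultimately show ?thesis
    using e(1) by (intro that[of e]) auto
qed

lemma weak_limit_Ioc_cross:
  assumes dist: "\<And>n. real_distribution (Qn1 n)" "\<And>n. real_distribution (Qn2 n)"
    "real_distribution Q1" "real_distribution Q2"
    and weak: "weak_conv_m Qn1 Q1" "weak_conv_m Qn2 Q2"
    and lr: "\<And>n. Qn1 n \<le>\<^sub>l\<^sub>r Qn2 n"
    and ord: "a < b" "b \<le> c" "c < d"
  shows "measure Q1 {c<..d} * measure Q2 {a<..b} \<le> measure Q1 {a<..b} * measure Q2 {c<..d}"
proof -
  interpret Q1: real_distribution Q1 by fact
  interpret Q2: real_distribution Q2 by fact
  interpret Qn1: real_distribution "Qn1 n" for n by fact
  interpret Qn2: real_distribution "Qn2 n" for n by fact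
  define D where "D = {x. measure Q1 {x} > 0} \<union> {x. measure Q2 {x} > 0}"
  have "countable D"
    using Q1.countable_atoms Q2.countable_atoms by (simp add: D_def)
  then obtain e where e: "\<And>k. 0 < e k" "e \<longlonglongrightarrow> 0" "\<And>k x. x \<in> {a,b,c,d} \<Longrightarrow> x + e k \<notin> D"
    by (rule exists_offset_avoiding_countable[of D "{a,b,c,d}"]) auto
  \<comment> \<open>Weak convergence yields convergence of distribution functions only at continuity
    points of the limit; outside \<open>D\<close> there are no atoms of \<open>Q1\<close> or
    \<open>Q2\<close>.\<close>
  have conv: "(\<lambda>n. cdf (Qn1 n) x) \<longlonglongrightarrow> cdf Q1 x" "(\<lambda>n. cdf (Qn2 n) x) \<longlonglongrightarrow> cdf Q2 x"
    if "x \<notin> D" for x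
    using that weak Q1.isCont_cdf[of x] Q2.isCont_cdf[of x]
    by (auto simp: D_def weak_conv_m_def weak_conv_def zero_less_measure_iff)
  have shifted: "(cdf Q1 (d + e k) - cdf Q1 (c + e k)) * (cdf Q2 (b + e k) - cdf Q2 (a + e k))
      \<le> (cdf Q1 (b + e k) - cdf Q1 (a + e k)) * (cdf Q2 (d + e k) - cdf Q2 (c + e k))" for k
  proof (rule LIMSEQ_le)
    show "(\<lambda>n. (cdf (Qn1 n) (d + e k) - cdf (Qn1 n) (c + e k)) *
          (cdf (Qn2 n) (b + e k) - cdf (Qn2 n) (a + e k)))
        \<longlonglongrightarrow> (cdf Q1 (d + e k) - cdf Q1 (c + e k)) * (cdf Q2 (b + e k) - cdf Q2 (a + e k))"
      using e(3) by (intro tendsto_intros conv) auto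
    show "(\<lambda>n. (cdf (Qn1 n) (b + e k) - cdf (Qn1 n) (a + e k)) *
          (cdf (Qn2 n) (d + e k) - cdf (Qn2 n) (c + e k)))
        \<longlonglongrightarrow> (cdf Q1 (b + e k) - cdf Q1 (a + e k)) * (cdf Q2 (d + e k) - cdf Q2 (c + e k))"
      using e(3) by (intro tendsto_intros conv) auto
    have "(cdf (Qn1 n) (d + e k) - cdf (Qn1 n) (c + e k)) *
          (cdf (Qn2 n) (b + e k) - cdf (Qn2 n) (a + e k))
        \<le> (cdf (Qn1 n) (b + e k) - cdf (Qn1 n) (a + e k)) *
          (cdf (Qn2 n) (d + e k) - cdf (Qn2 n) (c + e k))" for n
      \<comment> \<open>Even when \<open>b = c\<close>, the shifted intervals are strictly ordered,
        since the right one excludes its left endpoint.\<close>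
      using lr_le_cross[OF lr[of n], of "{a + e k<..b + e k}" "{c + e k<..d + e k}"] ord
      by (simp add: Qn1.cdf_diff_eq Qn2.cdf_diff_eq Qn1.emeasure_eq_measure
          Qn2.emeasure_eq_measure flip: ennreal_mult)
    then show "\<exists>N. \<forall>n\<ge>N. (cdf (Qn1 n) (d + e k) - cdf (Qn1 n) (c + e k)) *
          (cdf (Qn2 n) (b + e k) - cdf (Qn2 n) (a + e k))
        \<le> (cdf (Qn1 n) (b + e k) - cdf (Qn1 n) (a + e k)) *
          (cdf (Qn2 n) (d + e k) - cdf (Qn2 n) (c + e k))"
      by blast
  qed
  \<comment> \<open>The offsets are strictly positive, so the endpoints are approached from the
    right, where distribution functions are continuous even at atoms.\<close>
  have right: "filterlim (\<lambda>k. x + e k) (at_right x) sequentially" for x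
    using tendsto_add[OF tendsto_const e(2), of x] e(1)
    by (auto simp: filterlim_at less_imp_neq[symmetric] intro!: always_eventually)
  have lim: "(\<lambda>k. cdf Q1 (x + e k)) \<longlonglongrightarrow> cdf Q1 x" "(\<lambda>k. cdf Q2 (x + e k)) \<longlonglongrightarrow> cdf Q2 x" for x
    using Q1.cdf_is_right_cont[of x] Q2.cdf_is_right_cont[of x]
    by (auto simp: continuous_within intro: filterlim_compose[OF _ right])
  have "(cdf Q1 d - cdf Q1 c) * (cdf Q2 b - cdf Q2 a)
      \<le> (cdf Q1 b - cdf Q1 a) * (cdf Q2 d - cdf Q2 c)"
  proof (rule LIMSEQ_le)
    show "(\<lambda>k. (cdf Q1 (d + e k) - cdf Q1 (c + e k)) * (cdf Q2 (b + e k) - cdf Q2 (a + e k)))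
        \<longlonglongrightarrow> (cdf Q1 d - cdf Q1 c) * (cdf Q2 b - cdf Q2 a)"
      by (intro tendsto_intros lim)
    show "(\<lambda>k. (cdf Q1 (b + e k) - cdf Q1 (a + e k)) * (cdf Q2 (d + e k) - cdf Q2 (c + e k)))
        \<longlonglongrightarrow> (cdf Q1 b - cdf Q1 a) * (cdf Q2 d - cdf Q2 c)"
      by (intro tendsto_intros lim)
  qed (use shifted in blast)
  then show ?thesis
    using ord by (simp add: Q1.cdf_diff_eq Q2.cdf_diff_eq)
qed

section \<open>A monotone version of the density\<close>

text \<open>For finite \<open>c\<close>, the excess \<open>h - c\<close> is strictly positive on
  \<open>A\<close>, yet its integral over \<open>A\<close> is 0 once the finite term
  \<open>c * emeasure Q A\<close> is cancelled. For infinite \<open>c\<close> the set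
  \<open>A\<close> is empty.\<close>

lemma null_of_density_gt:
  fixes h :: "real \<Rightarrow> ennreal"
  assumes "finite_borel_measure Q" and h[measurable]: "h \<in> borel_measurable borel"
    and A[measurable]: "A \<in> sets borel" and gt: "\<And>x. x \<in> A \<Longrightarrow> c < h x"
    and le: "emeasure (density Q h) A \<le> c * emeasure Q A"
  shows "emeasure Q A = 0"
proof (cases "c = \<infinity>")
  case True
  then have "A = {}"
    using gt by fastforce
  then show ?thesis by simp
next
  case False
  interpret Q: finite_borel_measure Q by fact
  note [measurable_cong] = Q.M_is_borel
  have "emeasure (density Q h) A = (\<integral>\<^sup>+x. (h x - c) * indicator A x + c * indicator A x \<partial>Q)"
    using gt by (subst emeasure_density)
      (auto intro!: nn_integral_cong simp: indicator_def diff_add_cancel_ennreal less_imp_le)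
  also have "\<dots> = (\<integral>\<^sup>+x. (h x - c) * indicator A x \<partial>Q) + c * emeasure Q A"
    by (subst nn_integral_add) (auto simp: nn_integral_cmult_indicator)
  finally have "(\<integral>\<^sup>+x. (h x - c) * indicator A x \<partial>Q) + c * emeasure Q A \<le> 0 + c * emeasure Q A"
    using le by simp
  moreover have "c * emeasure Q A \<noteq> \<infinity>"
    using False by (simp add: ennreal_mult_eq_top_iff)
  ultimately have "(\<integral>\<^sup>+x. (h x - c) * indicator A x \<partial>Q) = 0"
    by (metis add.commute ennreal_add_left_cancel_le infinity_ennreal_def le_zero_eq)
  then have "AE x in Q. (h x - c) * indicator A x = 0"
    by (subst (asm) nn_integral_0_iff_AE) auto
  then have "AE x in Q. x \<notin> A"
  proof eventually_elim
    case (elim x)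
    then show ?case
      using gt[of x] by (auto simp: indicator_def diff_eq_0_iff_ennreal split: if_splits)
  qed
  then show ?thesis
    by (subst (asm) AE_iff_measurable[OF _ refl]) (auto simp: Q.borel_UNIV)
qed

text \<open>The exceptional sets are \<open>A\<close>, left of \<open>t\<close> with
  \<open>h\<close> above \<open>c\<close>, and \<open>B\<close>, right of \<open>t\<close> with
  \<open>h\<close> at most \<open>c\<close>. If both had positive mass, \<open>Q2\<close> would have
  the larger share of \<open>Q\<close> on the left set, against the cross inequality.\<close>

lemma density_dichotomy:
  fixes h :: "real \<Rightarrow> ennreal"
  assumes Q: "finite_borel_measure Q1" "finite_borel_measure Q2"
    and cross: "\<And>A B t. A \<in> sets borel \<Longrightarrow> A \<subseteq> {..t} \<Longrightarrow> B \<in> sets borel \<Longrightarrow> B \<subseteq> {t<..} \<Longrightarrow>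
        emeasure Q1 B * emeasure Q2 A \<le> emeasure Q1 A * emeasure Q2 B"
    and h[measurable]: "h \<in> borel_measurable borel"
    and dens: "density (add_measure Q1 Q2) h = Q2"
  shows "(AE x in add_measure Q1 Q2. x \<le> t \<longrightarrow> h x \<le> c) \<or>
    (AE x in add_measure Q1 Q2. t < x \<longrightarrow> c < h x)"
proof -
  define Q where "Q = add_measure Q1 Q2"
  interpret Q1: finite_borel_measure Q1 by fact
  interpret Q2: finite_borel_measure Q2 by fact
  interpret Q: finite_borel_measure Q
    unfolding Q_def by (rule finite_borel_measure_add_measure[OF Q])
  note [measurable_cong] = Q.M_is_borel
  define A where "A = {x. x \<le> t \<and> c < h x}"
  define B where "B = {x. t < x \<and> h x \<le> c}"
  have A_subset: "A \<subseteq> {..t}" and B_subset: "B \<subseteq> {t<..}"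
    by (auto simp: A_def B_def)
  have [measurable]: "A \<in> sets borel" "B \<in> sets borel"
    by (simp_all add: A_def B_def)
  have eq: "emeasure Q X = emeasure Q1 X + emeasure Q2 X" if "X \<in> sets borel" for X
    using that by (simp add: Q_def emeasure_add_measure Q1.M_is_borel Q2.M_is_borel)
  have "emeasure Q A = 0" if "emeasure Q B \<noteq> 0"
  proof (rule null_of_density_gt[OF Q.finite_borel_measure_axioms h])
    have "emeasure Q2 B = (\<integral>\<^sup>+x. h x * indicator B x \<partial>Q)"
      unfolding dens[folded Q_def, symmetric] by (subst emeasure_density) auto
    also have "\<dots> \<le> (\<integral>\<^sup>+x. c * indicator B x \<partial>Q)"
      by (intro nn_integral_mono) (auto simp: B_def indicator_def)
    finally have B: "emeasure Q2 B \<le> c * emeasure Q B"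
      by (simp add: nn_integral_cmult_indicator)
    \<comment> \<open>Adding \<open>emeasure Q2 B * emeasure Q2 A\<close> to both sides of the cross
      inequality replaces \<open>Q1\<close> by \<open>Q\<close>. The factor
      \<open>emeasure Q B\<close>, nonzero and finite, is cancelled at the end.\<close>
    have "emeasure Q B * emeasure Q2 A = emeasure Q1 B * emeasure Q2 A + emeasure Q2 B * emeasure Q2 A"
      by (simp add: eq distrib_right)
    also have "\<dots> \<le> emeasure Q1 A * emeasure Q2 B + emeasure Q2 B * emeasure Q2 A"
      using A_subset B_subset by (intro add_right_mono cross) auto
    also have "\<dots> = emeasure Q A * emeasure Q2 B"
      by (simp add: eq algebra_simps)
    also have "\<dots> \<le> emeasure Q B * (c * emeasure Q A)"
      using mult_left_mono[OF B, of "emeasure Q A"] by (simp add: ac_simps)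
    finally show "emeasure (density Q h) A \<le> c * emeasure Q A"
      using that by (simp add: dens[folded Q_def] ennreal_mult_le_mult_iff)
  qed (auto simp: A_def)
  moreover have "AE x in Q. x \<notin> X" if "emeasure Q X = 0" "X \<in> sets borel" for X
    using that by (intro AE_not_in) (auto simp: null_sets_def)
  ultimately have "(AE x in Q. x \<notin> A) \<or> (AE x in Q. x \<notin> B)"
    using \<open>A \<in> sets borel\<close> \<open>B \<in> sets borel\<close> by blast
  then show ?thesis
    unfolding Q_def[symmetric] A_def B_def by (simp add: imp_conv_disj not_less not_le)
qed

text \<open>For fixed \<open>c\<close>, the points \<open>t\<close> with \<open>P c t\<close> form
  an initial segment of the line. Almost everywhere, membership of \<open>x\<close> in it decides
  whether \<open>h x\<close> is at most \<open>c\<close>; countably many levels \<open>c\<close>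
  then determine \<open>h x\<close>.\<close>

lemma AE_eq_mono:
  fixes h :: "real \<Rightarrow> ennreal"
  assumes dich: "\<And>t c. (AE x in Q. x \<le> t \<longrightarrow> h x \<le> c) \<or> (AE x in Q. t < x \<longrightarrow> c < h x)"
  obtains \<rho> where "mono \<rho>" "AE x in Q. h x = \<rho> x"
proof
  define P where "P c t \<longleftrightarrow> (AE x in Q. x \<le> t \<longrightarrow> h x \<le> c)" for c and t :: real
  define \<rho> where "\<rho> t = Inf {c. P c t}" for t
  have P_mono: "P d s" if "P c t" "c \<le> d" "s \<le> t" for c d s t
    using that(1) unfolding P_def by eventually_elim (use that in auto)
  show "mono \<rho>"
    unfolding \<rho>_def by (intro monoI Inf_superset_mono) (auto intro: P_mono)
  \<comment> \<open>The null set in \<open>P c t\<close> depends on \<open>t\<close>; restricting to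
    rational points leaves a single null set for each \<open>c\<close>.\<close>
  have P_le: "AE x in Q. \<forall>q\<in>\<rat>. P c q \<longrightarrow> x \<le> q \<longrightarrow> h x \<le> c" for c
    by (subst AE_ball_countable) (auto simp: countable_rat P_def)
  \<comment> \<open>If the initial segment has a greatest element \<open>m\<close>, then
    \<open>P c m\<close> covers all of it. Otherwise every \<open>x\<close> in it lies below a
    rational point of the segment.\<close>
  have lower: "AE x in Q. P c x \<longrightarrow> h x \<le> c" for c
  proof (cases "\<exists>m. P c m \<and> (\<forall>y. P c y \<longrightarrow> y \<le> m)")
    case True
    then obtain m where "P c m" "\<And>y. P c y \<Longrightarrow> y \<le> m" by blast
    from this(1) show ?thesis
      unfolding P_def[of c m] by eventually_elim (use \<open>\<And>y. P c y \<Longrightarrow> y \<le> m\<close> in blast)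
  next
    case False
    show ?thesis
      using P_le[of c]
    proof eventually_elim
      case (elim x)
      show ?case
      proof
        assume "P c x"
        then obtain y where "P c y" "x < y"
          using False by (meson not_le)
        then obtain q where "q \<in> \<rat>" "x < q" "q < y"
          using Rats_dense_in_real by blast
        then show "h x \<le> c"
          using elim P_mono[OF \<open>P c y\<close>, of c q] by auto
      qed
    qed
  qed
  have upper: "AE x in Q. \<not> P c x \<longrightarrow> c < h x" for c
  proof -
    \<comment> \<open>Where \<open>P c q\<close> fails, the dichotomy leaves only its second
      alternative, to the right of \<open>q\<close>.\<close>
    have "AE x in Q. \<forall>q\<in>\<rat>. \<not> P c q \<longrightarrow> q < x \<longrightarrow> c < h x"
      using dich by (subst AE_ball_countable) (auto simp: countable_rat P_def)
    then show ?thesis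
    proof eventually_elim
      case (elim x)
      show ?case
      proof (intro impI, rule ccontr)
        assume "\<not> P c x" "\<not> c < h x"
        \<comment> \<open>Here \<open>x\<close> must be the least point violating \<open>P c\<close> (possibly an atom of \<open>Q\<close>).\<close>
        have "P c x"
          unfolding P_def using P_le[of c]
        proof eventually_elim
          case (elim z)
          show ?case
          proof
            assume "z \<le> x"
            show "h z \<le> c"
            proof (cases "z = x")
              case False
              then obtain q where "q \<in> \<rat>" "z < q" "q < x"
                using Rats_dense_in_real \<open>z \<le> x\<close> by (metis order_le_less)
              then show ?thesis
                using elim \<open>\<forall>q\<in>\<rat>. \<not> P c q \<longrightarrow> q < x \<longrightarrow> c < h x\<close> \<open>\<not> c < h x\<close> by auto
            qed (use \<open>\<not> c < h x\<close> in simp)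
          qed
        qed
        then show False
          using \<open>\<not> P c x\<close> by simp
      qed
    qed
  qed
  \<comment> \<open>Rational levels allow one common null set and still separate \<open>h x\<close>
    from \<open>\<rho> x\<close> if these differ. Negative rationals become level 0, which is
    harmless.\<close>
  have "AE x in Q. \<forall>r::rat. P (ennreal (real_of_rat r)) x \<longrightarrow> h x \<le> ennreal (real_of_rat r)"
    using lower by (subst AE_all_countable) auto
  moreover have "AE x in Q. \<forall>r::rat. \<not> P (ennreal (real_of_rat r)) x \<longrightarrow> ennreal (real_of_rat r) < h x"
    using upper by (subst AE_all_countable) auto
  ultimately show "AE x in Q. h x = \<rho> x"
  proof eventually_elim
    case (elim x)
    show ?case
    proof (rule antisym; rule ccontr)
      assume "\<not> h x \<le> \<rho> x"
      then obtain r :: rat where r: "\<rho> x < real_of_rat r" "real_of_rat r < h x"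
        using ennreal_rat_dense[of "\<rho> x" "h x"] by (auto simp: not_le)
      from r(1) obtain c where "P c x" "c < real_of_rat r"
        by (auto simp: \<rho>_def Inf_less_iff)
      then have "P (ennreal (real_of_rat r)) x"
        by (auto intro: P_mono)
      then show False
        using elim r by fastforce
    next
      assume "\<not> \<rho> x \<le> h x"
      then obtain r :: rat where r: "h x < real_of_rat r" "real_of_rat r < \<rho> x"
        using ennreal_rat_dense[of "h x" "\<rho> x"] by (auto simp: not_le)
      have "\<not> P (ennreal (real_of_rat r)) x"
        using r(2) Inf_lower[of "ennreal (real_of_rat r)" "{c. P c x}"] by (auto simp: \<rho>_def)
      then show False
        using elim r by fastforce
    qed
  qed
qed

section \<open>From cross inequality to monotone density ratio\<close>

lemma lr_le_of_cross:
  assumes Q: "finite_borel_measure Q1" "finite_borel_measure Q2"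
    and cross: "\<And>A B t. A \<in> sets borel \<Longrightarrow> A \<subseteq> {..t} \<Longrightarrow> B \<in> sets borel \<Longrightarrow> B \<subseteq> {t<..} \<Longrightarrow>
        emeasure Q1 B * emeasure Q2 A \<le> emeasure Q1 A * emeasure Q2 B"
  shows "Q1 \<le>\<^sub>l\<^sub>r Q2"
proof -
  define Q where "Q = add_measure Q1 Q2"
  interpret Q1: finite_borel_measure Q1 by fact
  interpret Q2: finite_borel_measure Q2 by fact
  interpret Q: finite_borel_measure Q
    unfolding Q_def by (rule finite_borel_measure_add_measure[OF Q])
  note [measurable_cong] = Q.M_is_borel
  have eq: "emeasure Q X = emeasure Q1 X + emeasure Q2 X" if "X \<in> sets borel" for X
    using that by (simp add: Q_def emeasure_add_measure Q1.M_is_borel Q2.M_is_borel)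
  have "absolutely_continuous Q Q2"
    by (auto simp: absolutely_continuous_def null_sets_def Q.M_is_borel Q2.M_is_borel eq)
  then obtain h where h[measurable]: "h \<in> borel_measurable Q" and dens: "density Q h = Q2"
    using Q.Radon_Nikodym_finite_measure[OF Q2.finite_measure_axioms]
    by (auto simp: Q.M_is_borel Q2.M_is_borel)
  have h'[measurable]: "h \<in> borel_measurable borel"
    using h Q.M_is_borel by (simp cong: measurable_cong_sets)
  \<comment> \<open>Since \<open>Q2\<close> is dominated by \<open>Q\<close>, the density
    \<open>h\<close> cannot exceed 1 on a set of positive mass.\<close>
  have "emeasure Q {x. 1 < h x} = 0"
    by (rule null_of_density_gt[OF Q.finite_borel_measure_axioms h', of _ 1])
       (auto simp: dens eq)
  then have "AE x in Q. x \<notin> {x. 1 < h x}"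
    by (intro AE_not_in) (auto simp: null_sets_def)
  then have h1: "AE x in Q. h x \<le> 1"
    by (simp add: not_less)
  have dich: "(AE x in Q. x \<le> t \<longrightarrow> h x \<le> c) \<or> (AE x in Q. t < x \<longrightarrow> c < h x)" for t c
    unfolding Q_def by (rule density_dichotomy[OF Q _ h' dens[unfolded Q_def]]) (rule cross)
  obtain \<rho> where \<rho>: "mono \<rho>" "AE x in Q. h x = \<rho> x"
    using AE_eq_mono[of h Q] dich by blast
  \<comment> \<open>As \<open>\<rho>\<close> agrees with \<open>h\<close> only almost everywhere, it
    may exceed 1 or be infinite on a null set. Capping at 1 keeps it monotone and makes both
    \<open>g\<close> and \<open>1 - g\<close> real and nonnegative everywhere.\<close>
  define g where "g x = enn2real (min (\<rho> x) 1)" for x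
  have g_enn: "ennreal (g x) = min (\<rho> x) 1" for x
    unfolding g_def by (rule ennreal_enn2real) (simp add: min_less_iff_disj)
  have g_mono: "mono g"
    using \<rho>(1) unfolding g_def mono_def by (auto intro!: enn2real_mono min.mono simp: min_less_iff_disj)
  have g_range: "0 \<le> g x" "g x \<le> 1" for x
    using enn2real_mono[of "min (\<rho> x) 1" 1] by (auto simp: g_def)
  have [measurable]: "g \<in> borel_measurable borel"
    using g_mono by (rule borel_measurable_mono)
  have hg: "AE x in Q. h x = ennreal (g x)"
    using h1 \<rho>(2) by eventually_elim (auto simp: g_enn min_def)
  have D2: "Q2 = density Q (\<lambda>x. ennreal (g x))"
    unfolding dens[symmetric] using hg by (intro density_cong) auto
  \<comment> \<open>The two densities sum to 1, so adding the finite value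
    \<open>emeasure Q2 X\<close> to either side gives \<open>emeasure Q X\<close>, and it can be
    cancelled.\<close>
  have D1: "Q1 = density Q (\<lambda>x. ennreal (1 - g x))"
  proof (rule measure_eqI)
    fix X assume "X \<in> sets Q1"
    then have X[measurable]: "X \<in> sets borel"
      by (simp add: Q1.M_is_borel)
    have "emeasure (density Q (\<lambda>x. ennreal (1 - g x))) X + emeasure Q2 X
        = (\<integral>\<^sup>+x. ennreal (1 - g x) * indicator X x + ennreal (g x) * indicator X x \<partial>Q)"
      by (simp add: D2 emeasure_density nn_integral_add)
    also have "\<dots> = (\<integral>\<^sup>+x. indicator X x \<partial>Q)"
      using g_range by (intro nn_integral_cong) (auto simp: indicator_def simp flip: ennreal_plus)
    also have "\<dots> = emeasure Q1 X + emeasure Q2 X"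
      by (simp add: eq)
    finally show "emeasure Q1 X = emeasure (density Q (\<lambda>x. ennreal (1 - g x))) X"
      by (simp add: Q2.emeasure_eq_measure)
  qed (simp add: Q1.M_is_borel Q.M_is_borel)
  have "ennreal (g x) / ennreal (1 - g x) \<le> ennreal (g y) / ennreal (1 - g y)" if "x \<le> y" for x y
  proof -
    have le: "g x \<le> g y"
      by (rule monoD[OF g_mono that])
    \<comment> \<open>At \<open>g y = 1\<close> the right side is the inverse of 0, hence infinite.
      The ratio is then a product of two factors that both increase with \<open>g\<close>.\<close>
    have "inverse (ennreal (1 - g x)) \<le> inverse (ennreal (1 - g y))"
    proof (cases "g y < 1")
      case True
      then show ?thesis
        using le by (auto simp: inverse_ennreal intro!: ennreal_leI le_imp_inverse_le)
    next
      case False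
      then show ?thesis
        by (simp add: ennreal_neg)
    qed
    then show ?thesis
      unfolding divide_ennreal_def using le by (intro mult_mono ennreal_leI) auto
  qed
  \<comment> \<open>The densities add up to 1, so the set on which monotonicity is required is the
    whole line.\<close>
  then have "mono_on {x. 0 < 1 - g x + g x} (\<lambda>x. ennreal (g x) / ennreal (1 - g x))"
    by (intro mono_onI)
  then show ?thesis
    unfolding lr_le_def using g_range
    by (intro exI[of _ Q] exI[of _ "\<lambda>x. 1 - g x"] exI[of _ g] conjI D1 D2
        Q.sigma_finite_measure_axioms Q.M_is_borel) simp_all
qed

theorem mainTheorem2:
  fixes Qn1 Qn2 :: "nat \<Rightarrow> real measure" and Q1 Q2 :: "real measure"
  assumes "\<And>n. real_distribution (Qn1 n)" and "\<And>n. real_distribution (Qn2 n)"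
    and "real_distribution Q1" and "real_distribution Q2"
    and "weak_conv_m Qn1 Q1" and "weak_conv_m Qn2 Q2"
    and "\<And>n. Qn1 n \<le>\<^sub>l\<^sub>r Qn2 n"
  shows "Q1 \<le>\<^sub>l\<^sub>r Q2"
proof -
  interpret Q1: real_distribution Q1 by fact
  interpret Q2: real_distribution Q2 by fact
  have Q: "finite_borel_measure Q1" "finite_borel_measure Q2" ..
  show ?thesis
  proof (rule lr_le_of_cross[OF Q])
    fix A B :: "real set" and t
    assume AB: "A \<in> sets borel" "A \<subseteq> {..t}" "B \<in> sets borel" "B \<subseteq> {t<..}"
    have "measure Q1 B * measure Q2 A \<le> measure Q1 A * measure Q2 B"
      by (rule cross_of_Ioc_cross[OF Q weak_limit_Ioc_cross[OF assms] AB])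
    then show "emeasure Q1 B * emeasure Q2 A \<le> emeasure Q1 A * emeasure Q2 B"
      by (simp add: Q1.emeasure_eq_measure Q2.emeasure_eq_measure flip: ennreal_mult)
  qed
qed

end
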